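(* Let $V:L^2([0,1])\to L^2([0,1])$ be a unitary operator (boundary unitary) and let $P_V$ be the associated selfadjoint extension of $P_{\min}$ in $L^2([0,1]^2)$. Then $P_V+1$ is unitarily equivalent to $P_V$.
   Context: All Hilbert spaces are complex. In $L^2([0,1]^2)$ let $P_{\min}=\frac{1}{i2\pi}\partial_x$ be the symmetric operator with domain the smooth functions compactly supported in the open unit square. Its adjoint is $P_{\max}=\frac{1}{i2\pi}\partial_x$ (distributional derivative) with domain $\{f\in L^2([0,1]^2)\mid \partial_x f\in L^2([0,1]^2)\}$. For $f\in\mathrm{dom}(P_{\max})$ the boundary values $f(0,\cdot),f(1,\cdot)$ are well-defined elements of $L^2([0,1])$. For a unitary operator $V$ on $L^2([0,1])$, $P_V$ denotes the restriction of $P_{\max}$ to the domain $\{f\in\mathrm{dom}(P_{\max})\mid f(1,\cdot)=Vf(0,\cdot)\}$; it is a selfadjoint extension of $P_{\min}$. Two (possibly unbounded) operators $A,B$ are unitarily equivalent if there is a unitary $W$ with $WA=BW$ (including equality of domains). *)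

theory Defs
  imports "HOL-Analysis.Analysis"
begin

section \<open>The complex Hilbert space \<open>L\<^sup>2(M)\<close>\<close>

text \<open>
  Elements of \<open>L\<^sup>2(M)\<close> are classes of square-integrable functions modulo equality almost
  everywhere.  The operations are computed on an arbitrarily chosen representative, the result
  being independent of the choice for arguments in \<^term>\<open>L2 M\<close>.
\<close>

definition square_int :: "'a measure \<Rightarrow> ('a \<Rightarrow> complex) set" where
  "square_int M = {u \<in> borel_measurable M. integrable M (\<lambda>x. (cmod (u x))\<^sup>2)}"

definition l2_class :: "'a measure \<Rightarrow> ('a \<Rightarrow> complex) \<Rightarrow> ('a \<Rightarrow> complex) set" where
  "l2_class M u = {v \<in> square_int M. AE x in M. v x = u x}"

definition L2 :: "'a measure \<Rightarrow> ('a \<Rightarrow> complex) set set" where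
  "L2 M = l2_class M ` square_int M"

definition l2_rep :: "('a \<Rightarrow> complex) set \<Rightarrow> 'a \<Rightarrow> complex" where
  "l2_rep f = (SOME u. u \<in> f)"

definition l2_add ::
  "'a measure \<Rightarrow> ('a \<Rightarrow> complex) set \<Rightarrow> ('a \<Rightarrow> complex) set \<Rightarrow> ('a \<Rightarrow> complex) set" where
  "l2_add M f g = l2_class M (\<lambda>x. l2_rep f x + l2_rep g x)"

definition l2_scale ::
  "'a measure \<Rightarrow> complex \<Rightarrow> ('a \<Rightarrow> complex) set \<Rightarrow> ('a \<Rightarrow> complex) set" where
  "l2_scale M c f = l2_class M (\<lambda>x. c * l2_rep f x)"

definition l2_inner ::
  "'a measure \<Rightarrow> ('a \<Rightarrow> complex) set \<Rightarrow> ('a \<Rightarrow> complex) set \<Rightarrow> complex" where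
  "l2_inner M f g = (LINT x|M. cnj (l2_rep f x) * l2_rep g x)"

text \<open>Only the values of a bounded operator on the carrier \<^term>\<open>L2 M\<close> are relevant.\<close>

definition unitary_on ::
  "'a measure \<Rightarrow> (('a \<Rightarrow> complex) set \<Rightarrow> ('a \<Rightarrow> complex) set) \<Rightarrow> bool" where
  "unitary_on M U \<longleftrightarrow>
     bij_betw U (L2 M) (L2 M) \<and>
     (\<forall>f\<in>L2 M. \<forall>g\<in>L2 M. U (l2_add M f g) = l2_add M (U f) (U g)) \<and>
     (\<forall>c. \<forall>f\<in>L2 M. U (l2_scale M c f) = l2_scale M c (U f)) \<and>
     (\<forall>f\<in>L2 M. \<forall>g\<in>L2 M. l2_inner M (U f) (U g) = l2_inner M f g)"

section \<open>Unbounded operators\<close>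

text \<open>
  A possibly unbounded operator \<open>A\<close> in \<open>L\<^sup>2(M)\<close> is given by its graph
  \<open>{(f, A f) | f \<in> dom A}\<close>, so that equality of graphs comprises equality of domains, the domain
  being \<^term>\<open>Domain A\<close>.
\<close>

type_synonym 'a l2_operator = "(('a \<Rightarrow> complex) set \<times> ('a \<Rightarrow> complex) set) set"

definition graph_of ::
  "'a measure \<Rightarrow> (('a \<Rightarrow> complex) set \<Rightarrow> ('a \<Rightarrow> complex) set) \<Rightarrow> 'a l2_operator" where
  "graph_of M U = {(f, U f) | f. f \<in> L2 M}"

definition plus_one :: "'a measure \<Rightarrow> 'a l2_operator \<Rightarrow> 'a l2_operator" where
  "plus_one M A = {(f, l2_add M g f) | f g. (f, g) \<in> A}"

text \<open>
  \<open>W A = B W\<close>.  Relational composition \<^term>\<open>R O S\<close> applies \<open>R\<close> first, so the factors appear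
  in reverse order.
\<close>

definition unitarily_equivalent :: "'a measure \<Rightarrow> 'a l2_operator \<Rightarrow> 'a l2_operator \<Rightarrow> bool" where
  "unitarily_equivalent M A B \<longleftrightarrow>
     (\<exists>W. unitary_on M W \<and> A O graph_of M W = graph_of M W O B)"

section \<open>The momentum operator on the unit square\<close>

abbreviation unit_interval :: "real measure" where
  "unit_interval \<equiv> restrict_space lborel {0..1}"

abbreviation unit_square :: "(real \<times> real) measure" where
  "unit_square \<equiv> restrict_space lborel ({0..1} \<times> {0..1})"

primrec C_k :: "nat \<Rightarrow> ('a::euclidean_space \<Rightarrow> 'b::real_normed_vector) \<Rightarrow> bool" where
  "C_k 0 f \<longleftrightarrow> continuous_on UNIV f"
| "C_k (Suc k) f \<longleftrightarrow>
     (\<forall>z. f differentiable (at z)) \<and> (\<forall>v. C_k k (\<lambda>z. frechet_derivative f (at z) v))"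

text \<open>
  Smooth functions with compact support in the open unit square, extended by zero to the plane;
  this is the domain of \<open>P_min\<close>.
\<close>

definition test_functions :: "(real \<times> real \<Rightarrow> complex) set" where
  "test_functions =
     {\<phi>. (\<forall>k. C_k k \<phi>) \<and> compact (closure {z. \<phi> z \<noteq> 0}) \<and>
         closure {z. \<phi> z \<noteq> 0} \<subseteq> {0<..<1} \<times> {0<..<1}}"

abbreviation partial_x :: "(real \<times> real \<Rightarrow> complex) \<Rightarrow> real \<times> real \<Rightarrow> complex" where
  "partial_x \<phi> z \<equiv> frechet_derivative \<phi> (at z) (1, 0)"

text \<open>\<open>g = \<partial>\<^sub>x f\<close> in the sense of distributions on the open unit square.\<close>

definition distr_partial_x ::
  "(real \<times> real \<Rightarrow> complex) set \<Rightarrow> (real \<times> real \<Rightarrow> complex) set \<Rightarrow> bool" where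
  "distr_partial_x f g \<longleftrightarrow>
     (\<forall>\<phi>\<in>test_functions.
        (LINT z|unit_square. l2_rep f z * partial_x \<phi> z) =
        - (LINT z|unit_square. l2_rep g z * \<phi> z))"

text \<open>\<open>P_max = (1 / (\<i> 2\<pi>)) \<partial>\<^sub>x\<close>, with domain all \<open>f \<in> L\<^sup>2\<close> such that \<open>\<partial>\<^sub>x f \<in> L\<^sup>2\<close>.\<close>

definition P_max :: "(real \<times> real) l2_operator" where
  "P_max = {(f, l2_scale unit_square (1 / (\<i> * 2 * of_real pi)) g) | f g.
              f \<in> L2 unit_square \<and> g \<in> L2 unit_square \<and> distr_partial_x f g}"

text \<open>
  The boundary value \<open>f(a, \<cdot>)\<close>, \<open>a \<in> {0, 1}\<close>.  Every \<open>f\<close> in the domain of \<^term>\<open>P_max\<close> has a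
  representative \<open>F\<close> that is (absolutely) continuous in \<open>x \<in> [0, 1]\<close> for almost every \<open>y\<close>, and
  \<open>F(a, \<cdot>)\<close> is then square-integrable.  Any two representatives continuous in \<open>x\<close> coincide, for
  almost every \<open>y\<close>, at all \<open>x \<in> [0, 1]\<close>, so the class of \<open>F(a, \<cdot>)\<close> is unique.
\<close>

definition boundary_value :: "real \<Rightarrow> (real \<times> real \<Rightarrow> complex) set \<Rightarrow> (real \<Rightarrow> complex) set" where
  "boundary_value a f =
     (THE h. h \<in> L2 unit_interval \<and>
        (\<exists>F\<in>f. (AE y in unit_interval. continuous_on {0..1} (\<lambda>x. F (x, y))) \<and>
               (\<lambda>y. F (a, y)) \<in> h))"

definition P_V :: "((real \<Rightarrow> complex) set \<Rightarrow> (real \<Rightarrow> complex) set) \<Rightarrow> (real \<times> real) l2_operator" where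
  "P_V V = {(f, g) \<in> P_max. boundary_value 1 f = V (boundary_value 0 f)}"

end

theory Submission
  imports Defs
begin

text \<open>
  Multiplication by \<open>e(x, y) = exp (2\<pi>\<i>x)\<close> is a unitary \<open>W\<close>.  By the product rule it conjugates
  \<open>\<partial>\<^sub>x / (2\<pi>\<i>)\<close> to itself plus one, and it does not change boundary values because \<open>e = 1\<close> at \<open>x = 0\<close>
  and at \<open>x = 1\<close>; hence it preserves every boundary condition \<open>f(1, \<cdot>) = V f(0, \<cdot>)\<close>.
\<close>

section \<open>Square-integrable functions and their classes\<close>

lemma borel_measurable_cnj [measurable]:
  "u \<in> borel_measurable M \<Longrightarrow> (\<lambda>x. cnj (u x)) \<in> borel_measurable M"
  by (rule borel_measurable_continuous_on[OF continuous_on_cnj[OF continuous_on_id]])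

lemma square_int_measurable: "u \<in> square_int M \<Longrightarrow> u \<in> borel_measurable M"
  by (simp add: square_int_def)

text \<open>Domination by \<open>B\<^sup>2\<close> times the squared modulus of \<open>u\<close>.
  Both scalar multiples and products with a unimodular function are instances.\<close>

lemma square_int_mult_bounded:
  assumes u: "u \<in> square_int M" and b: "b \<in> borel_measurable M"
    and B: "\<And>x. x \<in> space M \<Longrightarrow> cmod (b x) \<le> B"
  shows "(\<lambda>x. b x * u x) \<in> square_int M"
proof -
  have [measurable]: "u \<in> borel_measurable M" "b \<in> borel_measurable M"
    using u b by (auto simp: square_int_def)
  have "integrable M (\<lambda>x. B\<^sup>2 * (cmod (u x))\<^sup>2)"
    using u by (simp add: square_int_def)
  then have "integrable M (\<lambda>x. (cmod (b x * u x))\<^sup>2)"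
  proof (rule Bochner_Integration.integrable_bound)
    show "AE x in M. norm ((cmod (b x * u x))\<^sup>2) \<le> norm (B\<^sup>2 * (cmod (u x))\<^sup>2)"
    proof (rule AE_I2)
      fix x assume "x \<in> space M"
      then have "(cmod (b x))\<^sup>2 \<le> B\<^sup>2"
        using B by (intro power_mono) auto
      then show "norm ((cmod (b x * u x))\<^sup>2) \<le> norm (B\<^sup>2 * (cmod (u x))\<^sup>2)"
        by (simp add: norm_mult power_mult_distrib mult_right_mono)
    qed
  qed simp
  then show ?thesis by (simp add: square_int_def)
qed

lemma square_int_add:
  assumes u: "u \<in> square_int M" and v: "v \<in> square_int M"
  shows "(\<lambda>x. u x + v x) \<in> square_int M"
proof -
  have [measurable]: "u \<in> borel_measurable M" "v \<in> borel_measurable M"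
    using u v by (auto simp: square_int_def)
  have "integrable M (\<lambda>x. 2 * (cmod (u x))\<^sup>2 + 2 * (cmod (v x))\<^sup>2)"
    using u v by (simp add: square_int_def)
  then have "integrable M (\<lambda>x. (cmod (u x + v x))\<^sup>2)"
  proof (rule Bochner_Integration.integrable_bound)
    show "AE x in M. norm ((cmod (u x + v x))\<^sup>2)
            \<le> norm (2 * (cmod (u x))\<^sup>2 + 2 * (cmod (v x))\<^sup>2)"
    proof (rule AE_I2)
      fix x
      have "(cmod (u x + v x))\<^sup>2 \<le> (cmod (u x) + cmod (v x))\<^sup>2"
        by (intro power_mono norm_triangle_ineq) simp
      also have "\<dots> \<le> 2 * (cmod (u x))\<^sup>2 + 2 * (cmod (v x))\<^sup>2"
        using sum_squares_bound[of "cmod (u x)" "cmod (v x)"] by (simp add: power2_sum)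
      finally show "norm ((cmod (u x + v x))\<^sup>2)
            \<le> norm (2 * (cmod (u x))\<^sup>2 + 2 * (cmod (v x))\<^sup>2)" by simp
    qed
  qed simp
  then show ?thesis by (simp add: square_int_def)
qed

lemma square_int_scale: "u \<in> square_int M \<Longrightarrow> (\<lambda>x. c * u x) \<in> square_int M"
  by (rule square_int_mult_bounded[where B = "cmod c"]) auto

text \<open>On a finite measure space \<open>L2\<close> functions are integrable, since
  \<open>cmod (u x) \<le> 1 + (cmod (u x))\<^sup>2\<close> and constants are integrable. A bounded
  factor costs only the constant \<open>B\<close>.\<close>

lemma square_int_integrable_mult:
  assumes "finite_measure M" and u: "u \<in> square_int M" and b: "b \<in> borel_measurable M"
    and B: "\<And>x. x \<in> space M \<Longrightarrow> cmod (b x) \<le> B"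
  shows "integrable M (\<lambda>x. u x * b x)"
proof -
  interpret finite_measure M by fact
  have [measurable]: "u \<in> borel_measurable M" "b \<in> borel_measurable M"
    using u b by (auto simp: square_int_def)
  have "integrable M (\<lambda>x. (1 + (cmod (u x))\<^sup>2) * B)"
    using u by (simp add: square_int_def)
  then show ?thesis
  proof (rule Bochner_Integration.integrable_bound)
    show "AE x in M. norm (u x * b x) \<le> norm ((1 + (cmod (u x))\<^sup>2) * B)"
    proof (rule AE_I2)
      fix x assume x: "x \<in> space M"
      have "2 * cmod (u x) \<le> 1 + (cmod (u x))\<^sup>2"
        using sum_squares_bound[of 1 "cmod (u x)"] by simp
      then have "cmod (u x) \<le> 1 + (cmod (u x))\<^sup>2" using norm_ge_zero[of "u x"] by linarith
      then have "norm (u x * b x) \<le> (1 + (cmod (u x))\<^sup>2) * B"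
        unfolding norm_mult using B[OF x] by (intro mult_mono) auto
      then show "norm (u x * b x) \<le> norm ((1 + (cmod (u x))\<^sup>2) * B)" by simp
    qed
  qed simp
qed

section \<open>Passing between classes and representatives\<close>

lemma l2_class_cong:
  assumes "AE x in M. u x = v x"
  shows "l2_class M u = l2_class M v"
proof -
  have "(AE x in M. w x = u x) \<longleftrightarrow> (AE x in M. w x = v x)" for w
    by (rule eventually_subst) (use assms in eventually_elim, simp)
  then show ?thesis by (simp add: l2_class_def)
qed

lemma l2_class_in_L2: "u \<in> square_int M \<Longrightarrow> l2_class M u \<in> L2 M"
  by (simp add: L2_def)

lemma mem_l2_class: "u \<in> square_int M \<Longrightarrow> u \<in> l2_class M u"
  by (simp add: l2_class_def)

lemma l2_rep_mem: "f \<in> L2 M \<Longrightarrow> l2_rep f \<in> f"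
  unfolding l2_rep_def by (rule someI_ex[of "\<lambda>u. u \<in> f"]) (auto simp: L2_def intro: mem_l2_class)

lemma L2_subset_square_int: "f \<in> L2 M \<Longrightarrow> f \<subseteq> square_int M"
  by (auto simp: L2_def l2_class_def)

lemma l2_rep_square_int: "f \<in> L2 M \<Longrightarrow> l2_rep f \<in> square_int M"
  using l2_rep_mem L2_subset_square_int by blast

lemma l2_class_of_mem:
  assumes "f \<in> L2 M" "u \<in> f"
  shows "l2_class M u = f"
  using assms unfolding L2_def by (auto simp: l2_class_def[of M] elim: AE_mp intro!: l2_class_cong)

lemma l2_class_rep: "f \<in> L2 M \<Longrightarrow> l2_class M (l2_rep f) = f"
  by (simp add: l2_class_of_mem l2_rep_mem)

text \<open>A function chosen from the class of \<open>u\<close> is a member of it, so it agrees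
  with \<open>u\<close> off a null set. Together with \<open>l2_class_cong\<close> this reduces
  identities between classes to identities almost everywhere.\<close>

lemma l2_rep_class:
  assumes "u \<in> square_int M"
  shows "AE x in M. l2_rep (l2_class M u) x = u x"
  using l2_rep_mem[OF l2_class_in_L2[OF assms]] by (simp add: l2_class_def)

lemma mem_AE_l2_rep:
  assumes "f \<in> L2 M" "u \<in> f"
  shows "AE x in M. l2_rep f x = u x"
  using l2_rep_class[of u M] L2_subset_square_int[OF assms(1)] assms l2_class_of_mem[OF assms]
  by auto

lemma l2_add_in_L2: "f \<in> L2 M \<Longrightarrow> g \<in> L2 M \<Longrightarrow> l2_add M f g \<in> L2 M"
  unfolding l2_add_def by (intro l2_class_in_L2 square_int_add l2_rep_square_int)

lemma l2_scale_in_L2: "f \<in> L2 M \<Longrightarrow> l2_scale M c f \<in> L2 M"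
  unfolding l2_scale_def by (intro l2_class_in_L2 square_int_scale l2_rep_square_int)

lemma l2_rep_add:
  "f \<in> L2 M \<Longrightarrow> g \<in> L2 M \<Longrightarrow> AE x in M. l2_rep (l2_add M f g) x = l2_rep f x + l2_rep g x"
  unfolding l2_add_def by (intro l2_rep_class square_int_add l2_rep_square_int)

lemma l2_rep_scale: "f \<in> L2 M \<Longrightarrow> AE x in M. l2_rep (l2_scale M c f) x = c * l2_rep f x"
  unfolding l2_scale_def by (intro l2_rep_class square_int_scale l2_rep_square_int)

section \<open>Multiplication by a unimodular function\<close>

definition l2_mult ::
  "'a measure \<Rightarrow> ('a \<Rightarrow> complex) \<Rightarrow> ('a \<Rightarrow> complex) set \<Rightarrow> ('a \<Rightarrow> complex) set" where
  "l2_mult M e f = l2_class M (\<lambda>x. e x * l2_rep f x)"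

text \<open>The modulus is prescribed at every point, so \<open>cnj (e x) * e x = 1\<close> can be
  used inside almost-everywhere arguments without another exceptional set.\<close>

locale unimodular =
  fixes M :: "'a measure" and e :: "'a \<Rightarrow> complex"
  assumes measurable_e [measurable]: "e \<in> borel_measurable M"
    and norm_e: "cmod (e x) = 1"
begin

lemma cnj_mult_e: "cnj (e x) * e x = 1"
  by (metis complex_norm_square mult.commute norm_e of_real_1 one_power2)

text \<open>The conjugate is the pointwise inverse of \<open>e\<close>, so every fact of the locale
  also holds for the inverse multiplication.\<close>

lemma unimodular_cnj: "unimodular M (\<lambda>x. cnj (e x))"
  by unfold_locales (auto simp: norm_e)

lemma square_int_mult_e: "u \<in> square_int M \<Longrightarrow> (\<lambda>x. e x * u x) \<in> square_int M"
  by (rule square_int_mult_bounded[where B = 1]) (auto simp: norm_e)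

lemma l2_mult_in_L2: "f \<in> L2 M \<Longrightarrow> l2_mult M e f \<in> L2 M"
  unfolding l2_mult_def by (intro l2_class_in_L2 square_int_mult_e l2_rep_square_int)

lemma l2_rep_mult: "f \<in> L2 M \<Longrightarrow> AE x in M. l2_rep (l2_mult M e f) x = e x * l2_rep f x"
  unfolding l2_mult_def by (intro l2_rep_class square_int_mult_e l2_rep_square_int)

text \<open>Holds for every member \<open>F\<close> of the class, not only for
  \<open>l2_rep f\<close>. Boundary values need this, because they are read off a representative
  that is continuous in \<open>x\<close>.\<close>

lemma mult_mem_l2_mult:
  assumes "f \<in> L2 M" "F \<in> f"
  shows "(\<lambda>x. e x * F x) \<in> l2_mult M e f"
proof -
  have "AE x in M. e x * F x = e x * l2_rep f x"
    using mem_AE_l2_rep[OF assms] by eventually_elim simp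
  moreover have "(\<lambda>x. e x * F x) \<in> square_int M"
    using assms L2_subset_square_int by (intro square_int_mult_e) auto
  ultimately show ?thesis by (simp add: l2_mult_def l2_class_def)
qed

lemma l2_mult_cnj:
  assumes f: "f \<in> L2 M"
  shows "l2_mult M (\<lambda>x. cnj (e x)) (l2_mult M e f) = f"
proof -
  have "AE x in M. cnj (e x) * l2_rep (l2_mult M e f) x = l2_rep f x"
    using l2_rep_mult[OF f]
  proof eventually_elim
    case (elim x)
    then show ?case using cnj_mult_e[of x] by (simp add: mult.assoc[symmetric])
  qed
  then have "l2_mult M (\<lambda>x. cnj (e x)) (l2_mult M e f) = l2_class M (l2_rep f)"
    unfolding l2_mult_def[of M "\<lambda>x. cnj (e x)"] by (rule l2_class_cong)
  then show ?thesis by (simp add: l2_class_rep f)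
qed

lemma l2_mult_cnj':
  assumes "f \<in> L2 M"
  shows "l2_mult M e (l2_mult M (\<lambda>x. cnj (e x)) f) = f"
  using unimodular.l2_mult_cnj[OF unimodular_cnj assms] by simp

lemma l2_mult_add:
  assumes f: "f \<in> L2 M" and g: "g \<in> L2 M"
  shows "l2_mult M e (l2_add M f g) = l2_add M (l2_mult M e f) (l2_mult M e g)"
  unfolding l2_mult_def[of M e "l2_add M f g"] l2_add_def[of M "l2_mult M e f"]
proof (rule l2_class_cong)
  show "AE x in M. e x * l2_rep (l2_add M f g) x =
          l2_rep (l2_mult M e f) x + l2_rep (l2_mult M e g) x"
    using l2_rep_add[OF f g] l2_rep_mult[OF f] l2_rep_mult[OF g]
    by eventually_elim (simp add: distrib_left)
qed

lemma l2_mult_scale: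
  assumes f: "f \<in> L2 M"
  shows "l2_mult M e (l2_scale M c f) = l2_scale M c (l2_mult M e f)"
  unfolding l2_mult_def[of M e "l2_scale M c f"] l2_scale_def[of M c "l2_mult M e f"]
proof (rule l2_class_cong)
  show "AE x in M. e x * l2_rep (l2_scale M c f) x = c * l2_rep (l2_mult M e f) x"
    using l2_rep_scale[OF f, of c] l2_rep_mult[OF f] by eventually_elim simp
qed

lemma l2_inner_mult:
  assumes f: "f \<in> L2 M" and g: "g \<in> L2 M"
  shows "l2_inner M (l2_mult M e f) (l2_mult M e g) = l2_inner M f g"
  unfolding l2_inner_def
proof (rule integral_cong_AE)
  have [measurable]: "l2_rep (l2_mult M e f) \<in> borel_measurable M"
    "l2_rep (l2_mult M e g) \<in> borel_measurable M"
    "l2_rep f \<in> borel_measurable M" "l2_rep g \<in> borel_measurable M"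
    using f g by (auto intro!: square_int_measurable l2_rep_square_int l2_mult_in_L2)
  show "(\<lambda>x. cnj (l2_rep (l2_mult M e f) x) * l2_rep (l2_mult M e g) x) \<in> borel_measurable M"
    by measurable
  show "(\<lambda>x. cnj (l2_rep f x) * l2_rep g x) \<in> borel_measurable M"
    by measurable
  show "AE x in M. cnj (l2_rep (l2_mult M e f) x) * l2_rep (l2_mult M e g) x =
          cnj (l2_rep f x) * l2_rep g x"
    using l2_rep_mult[OF f] l2_rep_mult[OF g]
  proof eventually_elim
    case (elim x)
    have "cnj (e x * l2_rep f x) * (e x * l2_rep g x) =
          (cnj (e x) * e x) * (cnj (l2_rep f x) * l2_rep g x)" by simp
    then show ?case using elim cnj_mult_e[of x] by simp
  qed
qed

lemma unitary_on_l2_mult: "unitary_on M (l2_mult M e)"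
proof -
  have "bij_betw (l2_mult M e) (L2 M) (L2 M)"
    by (rule bij_betw_byWitness[where f' = "l2_mult M (\<lambda>x. cnj (e x))"])
      (auto simp: l2_mult_cnj l2_mult_cnj' l2_mult_in_L2
        unimodular.l2_mult_in_L2[OF unimodular_cnj])
  then show ?thesis
    by (simp add: unitary_on_def l2_mult_add l2_mult_scale l2_inner_mult)
qed

end

section \<open>Products of smooth functions\<close>

text \<open>\<open>C_k (Suc k)\<close> speaks only of differentiability and of the derivatives. The
  base case is that differentiable functions are continuous; later steps apply the induction
  hypothesis to the directional derivatives.\<close>

lemma C_k_Suc_imp_C_k: "C_k (Suc k) f \<Longrightarrow> C_k k f"
proof (induction k arbitrary: f)
  case 0
  then show ?case
    by (auto intro!: continuous_at_imp_continuous_on differentiable_imp_continuous_within)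
qed auto

lemma C_k_add: "C_k k f \<Longrightarrow> C_k k g \<Longrightarrow> C_k k (\<lambda>z. f z + g z)"
proof (induction k arbitrary: f g)
  case (Suc k)
  have "frechet_derivative (\<lambda>z. f z + g z) (at z) =
          (\<lambda>v. frechet_derivative f (at z) v + frechet_derivative g (at z) v)" for z
    using Suc.prems
    by (intro frechet_derivative_at[symmetric] has_derivative_add)
      (auto simp: frechet_derivative_works[symmetric])
  then show ?case using Suc by auto
qed (auto intro: continuous_intros)

lemma frechet_derivative_mult:
  fixes f g :: "'a::euclidean_space \<Rightarrow> 'b::real_normed_algebra"
  assumes "f differentiable (at z)" "g differentiable (at z)"
  shows "frechet_derivative (\<lambda>z. f z * g z) (at z) v =
           f z * frechet_derivative g (at z) v + frechet_derivative f (at z) v * g z"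
proof -
  have "((\<lambda>z. f z * g z) has_derivative
          (\<lambda>v. f z * frechet_derivative g (at z) v + frechet_derivative f (at z) v * g z)) (at z)"
    using assms by (intro has_derivative_mult) (auto simp: frechet_derivative_works[symmetric])
  then show ?thesis by (simp flip: frechet_derivative_at)
qed

text \<open>Induction with both factors arbitrary: by the product rule a derivative of the product
  is a sum of products of functions of class \<open>C_k k\<close>. The undifferentiated factors are
  one order smoother and are first lowered by \<open>C_k_Suc_imp_C_k\<close>.\<close>

lemma C_k_mult:
  fixes f g :: "'a::euclidean_space \<Rightarrow> 'b::real_normed_algebra"
  shows "C_k k f \<Longrightarrow> C_k k g \<Longrightarrow> C_k k (\<lambda>z. f z * g z)"
proof (induction k arbitrary: f g)
  case (Suc k)
  have "C_k k f" "C_k k g" using Suc.prems by (auto simp del: C_k.simps intro: C_k_Suc_imp_C_k)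
  moreover have "C_k k (\<lambda>z. frechet_derivative f (at z) v)"
    "C_k k (\<lambda>z. frechet_derivative g (at z) v)" for v using Suc.prems by auto
  ultimately have "C_k k (\<lambda>z. f z * frechet_derivative g (at z) v + frechet_derivative f (at z) v * g z)"
    for v by (intro C_k_add Suc.IH)
  then show ?case
    using Suc.prems by (auto simp: frechet_derivative_mult intro: differentiable_mult)
qed (auto intro: continuous_intros)

section \<open>The phase function\<close>

text \<open>Integrality of \<open>n\<close> makes the phase equal to 1 at \<open>x = 1\<close> as
  well as at \<open>x = 0\<close>. A general \<open>n\<close> is kept so that
  \<open>phase (- n)\<close>, the inverse of \<open>phase n\<close>, is covered by the same
  lemmas.\<close>

definition phase :: "int \<Rightarrow> real \<times> real \<Rightarrow> complex" where
  "phase n z = exp (2 * of_real pi * \<i> * of_int n * of_real (fst z))"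

lemma phase_eq_cis: "phase n z = cis (2 * pi * of_int n * fst z)"
  by (simp add: phase_def cis_conv_exp mult_ac)

lemma cnj_phase: "cnj (phase n z) = phase (- n) z"
  by (simp add: phase_eq_cis cis_cnj)

lemma phase_0_left [simp]: "phase n (0, y) = 1"
  by (simp add: phase_def)

lemma phase_1_left [simp]: "phase n (1, y) = 1"
  using cis_multiple_2pi[of "of_int n"] by (simp add: phase_eq_cis)

lemma phase_has_derivative:
  "(phase n has_derivative
     (\<lambda>v. 2 * of_real pi * \<i> * of_int n * of_real (fst v) * phase n z)) (at z)"
proof -
  have "((\<lambda>z. 2 * of_real pi * \<i> * of_int n * of_real (fst z)) has_derivative
          (\<lambda>v. 2 * of_real pi * \<i> * of_int n * of_real (fst v))) (at z)"
    by (auto intro!: derivative_eq_intros)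
  from has_derivative_compose[OF this DERIV_exp[unfolded has_field_derivative_def]]
  show ?thesis by (simp add: phase_def[abs_def] mult_ac)
qed

lemma frechet_derivative_phase:
  "frechet_derivative (phase n) (at z) v =
     2 * of_real pi * \<i> * of_int n * of_real (fst v) * phase n z"
  using frechet_derivative_at[OF phase_has_derivative] by metis

lemma differentiable_phase: "phase n differentiable (at z)"
  using phase_has_derivative differentiableI by blast

lemma continuous_on_phase: "continuous_on S (phase n)"
  by (simp add: continuous_at_imp_continuous_on differentiable_phase
      differentiable_imp_continuous_within)

lemma C_k_const: "C_k k (\<lambda>z. c)"
  by (induction k arbitrary: c) auto

text \<open>Each directional derivative is a constant multiple of the phase itself, so the induction
  closes.\<close>

lemma C_k_phase: "C_k k (phase n)"
proof (induction k)
  case (Suc k)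
  have "C_k k (\<lambda>z. 2 * of_real pi * \<i> * of_int n * of_real (fst v) * phase n z)" for v :: "real \<times> real"
    by (intro C_k_mult C_k_const Suc.IH)
  then show ?case by (simp add: differentiable_phase frechet_derivative_phase)
qed (simp add: continuous_on_phase)

text \<open>The phase is smooth and has no zeros, so the product is smooth and has the same
  support.\<close>

lemma test_functions_mult_phase:
  assumes "\<phi> \<in> test_functions"
  shows "(\<lambda>z. phase n z * \<phi> z) \<in> test_functions"
proof -
  have "{z. phase n z * \<phi> z \<noteq> 0} = {z. \<phi> z \<noteq> 0}" by (simp add: phase_def)
  then show ?thesis
    using assms by (simp add: test_functions_def C_k_mult C_k_phase)
qed

lemma partial_x_mult_phase:
  assumes "\<phi> \<in> test_functions"
  shows "partial_x (\<lambda>z. phase n z * \<phi> z) z =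
           phase n z * partial_x \<phi> z + 2 * of_real pi * \<i> * of_int n * (phase n z * \<phi> z)"
proof -
  have "C_k (Suc 0) \<phi>" using assms unfolding test_functions_def by blast
  then have "\<phi> differentiable (at z)" by (simp del: split_paired_All)
  then show ?thesis
    by (simp add: frechet_derivative_mult differentiable_phase frechet_derivative_phase mult_ac)
qed

lemma continuous_on_test_function: "\<phi> \<in> test_functions \<Longrightarrow> continuous_on UNIV \<phi>"
  unfolding test_functions_def by (metis (mono_tags, lifting) C_k.simps(1) mem_Collect_eq)

lemma continuous_on_partial_x:
  assumes "\<phi> \<in> test_functions"
  shows "continuous_on UNIV (partial_x \<phi>)"
proof -
  have "C_k (Suc 0) \<phi>" using assms unfolding test_functions_def by blast
  then show ?thesis by simp
qed

section \<open>Conjugating the momentum operator by a phase\<close>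

lemma measurable_unit_square:
  "continuous_on UNIV (b :: real \<times> real \<Rightarrow> complex) \<Longrightarrow> b \<in> borel_measurable unit_square"
  by (intro measurable_restrict_space1) (simp add: borel_measurable_continuous_onI)

lemma space_unit_square: "space unit_square = {0..1} \<times> {0..1}"
  by (simp add: space_restrict_space)

lemma finite_measure_unit_square: "finite_measure unit_square"
proof (rule finite_measureI)
  have "emeasure unit_square (space unit_square) = emeasure lborel ({0..1::real} \<times> {0..1::real})"
    unfolding space_unit_square by (rule emeasure_restrict_space) (auto intro!: borel_closed closed_Times)
  also have "\<dots> < \<infinity>"
    by (intro emeasure_bounded_finite bounded_Times) auto
  finally show "emeasure unit_square (space unit_square) \<noteq> \<infinity>" by simp
qed

lemma integrable_L2_mult_continuous:
  assumes f: "f \<in> L2 unit_square" and b: "continuous_on UNIV (b :: real \<times> real \<Rightarrow> complex)"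
  shows "integrable unit_square (\<lambda>z. l2_rep f z * b z)"
proof -
  have "compact (b ` ({0..1} \<times> {0..1}))"
    using b by (intro compact_continuous_image compact_Times) (auto intro: continuous_on_subset)
  then obtain B where "\<And>z. z \<in> {0..1} \<times> {0..1} \<Longrightarrow> cmod (b z) \<le> B"
    by (metis bounded_iff compact_imp_bounded imageI)
  then show ?thesis
    using f b
    by (intro square_int_integrable_mult[where B = B] finite_measure_unit_square l2_rep_square_int
        measurable_unit_square) (auto simp: space_unit_square)
qed

text \<open>The representative picked from a class is unknown, but integrals see it only up to a
  null set. This lets an explicit function such as a phase times \<open>l2_rep f\<close> take its
  place.\<close>

lemma integral_l2_class_mult:
  assumes u: "u \<in> square_int unit_square" and b: "continuous_on UNIV (b :: real \<times> real \<Rightarrow> complex)"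
  shows "(LINT z|unit_square. l2_rep (l2_class unit_square u) z * b z) =
         (LINT z|unit_square. u z * b z)"
proof (rule integral_cong_AE)
  have [measurable]: "b \<in> borel_measurable unit_square" "u \<in> borel_measurable unit_square"
    "l2_rep (l2_class unit_square u) \<in> borel_measurable unit_square"
    using u b measurable_unit_square
    by (auto intro!: square_int_measurable l2_rep_square_int l2_class_in_L2)
  show "(\<lambda>z. l2_rep (l2_class unit_square u) z * b z) \<in> borel_measurable unit_square"
    "(\<lambda>z. u z * b z) \<in> borel_measurable unit_square" by measurable
  show "AE z in unit_square. l2_rep (l2_class unit_square u) z * b z = u z * b z"
    using l2_rep_class[OF u] by eventually_elim simp
qed

text \<open>The factor \<open>1 / (\<i> * 2 * of_real pi)\<close> is moved into the weak identity,
  which then relates \<open>f\<close> and \<open>h\<close> directly, without the intermediate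
  distributional derivative.\<close>

lemma P_max_iff:
  "(f, h) \<in> P_max \<longleftrightarrow> f \<in> L2 unit_square \<and> h \<in> L2 unit_square \<and>
     (\<forall>\<phi>\<in>test_functions.
        (LINT z|unit_square. l2_rep f z * partial_x \<phi> z) =
        - (2 * of_real pi * \<i> * (LINT z|unit_square. l2_rep h z * \<phi> z)))"
    (is "_ \<longleftrightarrow> ?R")
proof -
  have scale: "(LINT z|unit_square. l2_rep (l2_scale unit_square c g) z * \<phi> z) =
      c * (LINT z|unit_square. l2_rep g z * \<phi> z)"
    if "g \<in> L2 unit_square" "\<phi> \<in> test_functions" for c g \<phi>
    unfolding l2_scale_def
    using that integral_l2_class_mult[of "\<lambda>z. c * l2_rep g z" \<phi>]
    by (simp add: square_int_scale l2_rep_square_int continuous_on_test_function mult.assoc)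
  show ?thesis
  proof
    assume "(f, h) \<in> P_max"
    then show ?R by (auto simp: P_max_def distr_partial_x_def scale l2_scale_in_L2)
  next
    assume R: ?R
    \<comment> \<open>The distributional derivative of \<open>f\<close>, found by solving
      \<open>h = g / (2\<pi>\<i>)\<close> for \<open>g\<close>.\<close>
    define g where "g = l2_scale unit_square (2 * of_real pi * \<i>) h"
    have g: "g \<in> L2 unit_square" using R by (simp add: g_def l2_scale_in_L2)
    have "AE z in unit_square. 1 / (\<i> * 2 * of_real pi) * l2_rep g z = l2_rep h z"
      using l2_rep_scale[of h unit_square "2 * of_real pi * \<i>"] R
      by (auto simp: g_def elim: AE_mp)
    then have "l2_scale unit_square (1 / (\<i> * 2 * of_real pi)) g = h"
      unfolding l2_scale_def using R l2_class_rep l2_class_cong by metis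
    moreover have "distr_partial_x f g"
      using R by (simp add: distr_partial_x_def g_def scale)
    ultimately show "(f, h) \<in> P_max"
      using R g unfolding P_max_def by blast
  qed
qed

section \<open>Multiplication by a phase acting on \<open>P_max\<close>, boundary values and
  \<open>P_V\<close>\<close>

lemma unimodular_phase: "unimodular unit_square (phase n)"
  by unfold_locales (auto simp: phase_eq_cis intro!: measurable_unit_square continuous_on_phase)

lemma l2_mult_phase_inverse:
  "f \<in> L2 unit_square \<Longrightarrow>
     l2_mult unit_square (phase (- n)) (l2_mult unit_square (phase n) f) = f"
  using unimodular.l2_mult_cnj[OF unimodular_phase, of f n] by (simp add: cnj_phase)

text \<open>Writing \<open>e\<close> for the phase, this is \<open>P (e f) = e (P f + n f)\<close>
  in weak form. Testing \<open>e f\<close> against \<phi> amounts to testing \<open>f\<close>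
  against \<open>e \<phi>\<close>, which is again a test function, and the extra term of the product
  rule produces \<open>n f\<close>.\<close>

lemma P_max_mult_phase:
  assumes "(f, h) \<in> P_max"
  shows "(l2_mult unit_square (phase n) f,
          l2_class unit_square (\<lambda>z. phase n z * (l2_rep h z + of_int n * l2_rep f z))) \<in> P_max"
    (is "(?f, l2_class _ ?h) \<in> _")
proof -
  interpret unimodular unit_square "phase n" by (rule unimodular_phase)
  have f: "f \<in> L2 unit_square" and h: "h \<in> L2 unit_square"
    using assms by (auto simp: P_max_iff)
  have h': "?h \<in> square_int unit_square"
    using f h by (intro square_int_mult_e square_int_add square_int_scale l2_rep_square_int)
  have "(LINT z|unit_square. l2_rep ?f z * partial_x \<phi> z) =
      - (2 * of_real pi * \<i> * (LINT z|unit_square. l2_rep (l2_class unit_square ?h) z * \<phi> z))"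
    if \<phi>: "\<phi> \<in> test_functions" for \<phi>
  proof -
    let ?\<psi> = "\<lambda>z. phase n z * \<phi> z"
    have \<psi>: "?\<psi> \<in> test_functions" using \<phi> by (rule test_functions_mult_phase)
    note int = integrable_L2_mult_continuous[OF f continuous_on_partial_x[OF \<psi>]]
      integrable_L2_mult_continuous[OF f continuous_on_test_function[OF \<psi>]]
      integrable_L2_mult_continuous[OF h continuous_on_test_function[OF \<psi>]]
    have "(LINT z|unit_square. l2_rep ?f z * partial_x \<phi> z) =
        (LINT z|unit_square. (phase n z * l2_rep f z) * partial_x \<phi> z)"
      unfolding l2_mult_def
      using f \<phi> by (intro integral_l2_class_mult square_int_mult_e l2_rep_square_int
          continuous_on_partial_x)
    \<comment> \<open>The product rule solved for the phase times \<open>partial_x \<phi>\<close>,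
      so that the weak identity for \<open>f\<close> applies to \<open>?\<psi>\<close>.\<close>
    also have "\<dots> = (LINT z|unit_square. l2_rep f z * partial_x ?\<psi> z
        - 2 * of_real pi * \<i> * of_int n * (l2_rep f z * ?\<psi> z))"
      unfolding partial_x_mult_phase[OF \<phi>] by (simp add: algebra_simps)
    also have "\<dots> = (LINT z|unit_square. l2_rep f z * partial_x ?\<psi> z)
        - 2 * of_real pi * \<i> * of_int n * (LINT z|unit_square. l2_rep f z * ?\<psi> z)"
      using int by (subst Bochner_Integration.integral_diff) auto
    also have "(LINT z|unit_square. l2_rep f z * partial_x ?\<psi> z) =
        - (2 * of_real pi * \<i> * (LINT z|unit_square. l2_rep h z * ?\<psi> z))"
      using assms \<psi> by (simp add: P_max_iff)
    finally have 1: "(LINT z|unit_square. l2_rep ?f z * partial_x \<phi> z) =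
        - (2 * of_real pi * \<i> * (LINT z|unit_square. l2_rep h z * ?\<psi> z))
        - 2 * of_real pi * \<i> * of_int n * (LINT z|unit_square. l2_rep f z * ?\<psi> z)" .
    have "(LINT z|unit_square. l2_rep (l2_class unit_square ?h) z * \<phi> z) =
        (LINT z|unit_square. ?h z * \<phi> z)"
      using h' \<phi> by (intro integral_l2_class_mult continuous_on_test_function)
    also have "\<dots> = (LINT z|unit_square. l2_rep h z * ?\<psi> z + of_int n * (l2_rep f z * ?\<psi> z))"
      by (rule Bochner_Integration.integral_cong) (simp_all add: algebra_simps)
    also have "\<dots> = (LINT z|unit_square. l2_rep h z * ?\<psi> z)
        + of_int n * (LINT z|unit_square. l2_rep f z * ?\<psi> z)"
      using int by (subst Bochner_Integration.integral_add) auto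
    finally show ?thesis using 1 by (simp add: algebra_simps)
  qed
  then show ?thesis using f h' by (simp add: P_max_iff l2_mult_in_L2 l2_class_in_L2)
qed

text \<open>
  The phase identifies the functions admitted in the definition of the boundary value of \<open>f\<close> with
  those admitted for its multiple, so neither existence nor uniqueness of boundary values matters.
\<close>

lemma boundary_value_mult_phase:
  assumes f: "f \<in> L2 unit_square" and a: "a = 0 \<or> a = 1"
  shows "boundary_value a (l2_mult unit_square (phase n) f) = boundary_value a f"
proof -
  define admits where "admits f h \<longleftrightarrow>
      (\<exists>F\<in>f. (AE y in unit_interval. continuous_on {0..1} (\<lambda>x. F (x, y))) \<and> (\<lambda>y. F (a, y)) \<in> h)"
    for f :: "(real \<times> real \<Rightarrow> complex) set" and h :: "(real \<Rightarrow> complex) set"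
  have *: "admits (l2_mult unit_square (phase m) g) h"
    if g: "g \<in> L2 unit_square" and gh: "admits g h" for g h m
  proof -
    obtain F where F: "F \<in> g" "AE y in unit_interval. continuous_on {0..1} (\<lambda>x. F (x, y))"
      "(\<lambda>y. F (a, y)) \<in> h" using gh by (auto simp: admits_def)
    have "AE y in unit_interval. continuous_on {0..1} (\<lambda>x. phase m (x, y) * F (x, y))"
      using F(2)
    proof eventually_elim
      case (elim y)
      have "continuous_on {0..1} (\<lambda>x. phase m (x, y))"
        unfolding phase_def by (intro continuous_intros)
      then show ?case using elim by (rule continuous_on_mult)
    qed
    moreover have "(\<lambda>y. phase m (a, y) * F (a, y)) \<in> h" using a F(3) by auto
    ultimately show ?thesis
      unfolding admits_def
      by (intro bexI[OF _ unimodular.mult_mem_l2_mult[OF unimodular_phase g F(1)]]) simp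
  qed
  \<comment> \<open>The converse is the same implication for \<open>- n\<close>, applied to the
    multiplied class, since \<open>phase (- n)\<close> undoes \<open>phase n\<close>.\<close>
  have "admits (l2_mult unit_square (phase n) f) h \<longleftrightarrow> admits f h" for h
    using *[OF f] *[of "l2_mult unit_square (phase n) f" h "- n"]
      l2_mult_phase_inverse[OF f] unimodular.l2_mult_in_L2[OF unimodular_phase f]
    by metis
  then show ?thesis unfolding boundary_value_def admits_def by simp
qed

text \<open>The boundary values at 0 and at 1 are both unchanged, so the condition imposed by
  \<open>V\<close> carries over verbatim from \<open>f\<close> to its multiple.\<close>

lemma P_V_mult_phase:
  assumes "(f, h) \<in> P_V V"
  shows "(l2_mult unit_square (phase n) f,
          l2_class unit_square (\<lambda>z. phase n z * (l2_rep h z + of_int n * l2_rep f z))) \<in> P_V V"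
  using assms P_max_mult_phase[of f h n]
  by (auto simp: P_V_def P_max_iff boundary_value_mult_phase)

theorem theorem1p2:
  fixes V :: "(real \<Rightarrow> complex) set \<Rightarrow> (real \<Rightarrow> complex) set"
  assumes "unitary_on unit_interval V"
  shows "unitarily_equivalent unit_square (plus_one unit_square (P_V V)) (P_V V)"
proof -
  interpret unimodular unit_square "phase 1" by (rule unimodular_phase)
  let ?W = "l2_mult unit_square (phase 1)"
  have L2: "f \<in> L2 unit_square" "g \<in> L2 unit_square" if "(f, g) \<in> P_V V" for f g
    using that by (auto simp: P_V_def P_max_iff)
  \<comment> \<open>Brings \<open>?W\<close> of the sum into the form of the second component in
    \<open>P_V_mult_phase\<close> for \<open>n = 1\<close>. Both inclusions use it.\<close>
  have W_add: "?W (l2_add unit_square g f) =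
      l2_class unit_square (\<lambda>z. phase 1 z * (l2_rep g z + l2_rep f z))"
    if "f \<in> L2 unit_square" "g \<in> L2 unit_square" for f g
    unfolding l2_mult_def
    using l2_rep_add[OF that(2,1)] by (intro l2_class_cong) (auto elim: AE_mp)
  have "plus_one unit_square (P_V V) O graph_of unit_square ?W = graph_of unit_square ?W O P_V V"
  proof (intro equalityI subsetI)
    fix p assume "p \<in> plus_one unit_square (P_V V) O graph_of unit_square ?W"
    then obtain f g where p: "p = (f, ?W (l2_add unit_square g f))" and fg: "(f, g) \<in> P_V V"
      by (auto simp: plus_one_def graph_of_def)
    have "(?W f, ?W (l2_add unit_square g f)) \<in> P_V V"
      using P_V_mult_phase[OF fg, of 1] by (simp add: W_add L2[OF fg])
    then show "p \<in> graph_of unit_square ?W O P_V V"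
      using L2[OF fg] by (auto simp: p graph_of_def)
  next
    fix p assume "p \<in> graph_of unit_square ?W O P_V V"
    then obtain f k where p: "p = (f, k)" and f: "f \<in> L2 unit_square" and k: "(?W f, k) \<in> P_V V"
      by (auto simp: graph_of_def)
    \<comment> \<open>\<open>?W (g + f) = k\<close> forces \<open>g\<close> to be the inverse phase
      times \<open>k - ?W f\<close>. This is the second component that \<open>P_V_mult_phase\<close>
      gives for \<open>n = - 1\<close> at the pair \<open>(?W f, k)\<close>.\<close>
    let ?u = "\<lambda>z. phase (- 1) z * (l2_rep k z + of_int (- 1) * l2_rep (?W f) z)"
    define g where "g = l2_class unit_square ?u"
    \<comment> \<open>Here lies the equality of domains: if \<open>?W f\<close> is in the domain of
      \<open>P_V V\<close>, then multiplying back by \<open>phase (- 1)\<close> shows that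
      \<open>f\<close> is.\<close>
    have fg: "(f, g) \<in> P_V V"
      using P_V_mult_phase[OF k, of "- 1"] l2_mult_phase_inverse[OF f, of 1] by (simp add: g_def)
    have "?u \<in> square_int unit_square"
      by (intro unimodular.square_int_mult_e[OF unimodular_phase] square_int_add square_int_scale
          l2_rep_square_int L2[OF k])
    then have "AE z in unit_square. l2_rep g z = ?u z"
      unfolding g_def by (rule l2_rep_class)
    then have "AE z in unit_square. phase 1 z * (l2_rep g z + l2_rep f z) = l2_rep k z"
      using l2_rep_mult[OF f]
    proof eventually_elim
      case (elim z)
      have "phase 1 z * phase (- 1) z = 1"
        using cnj_mult_e[of z] by (simp add: cnj_phase mult.commute)
      then show ?case using elim by (simp add: algebra_simps)
    qed
    then have "?W (l2_add unit_square g f) = l2_class unit_square (l2_rep k)"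
      unfolding W_add[OF L2[OF fg]] by (rule l2_class_cong)
    then have "?W (l2_add unit_square g f) = k"
      using L2[OF k] by (simp add: l2_class_rep)
    then show "p \<in> plus_one unit_square (P_V V) O graph_of unit_square ?W"
      using fg l2_add_in_L2[OF L2(2)[OF fg] L2(1)[OF fg]]
      unfolding p plus_one_def graph_of_def by blast
  qed
  then show ?thesis
    using unitary_on_l2_mult unfolding unitarily_equivalent_def by blast
qed

end
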